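(* Let $\mathcal{R}$ be the feasible region of a PPICOD problem and let $\mathcal{R}_2$ be the set of code length--satisfaction pairs collected by the code-centric method (Method 2, defined in the context). Then $\mathcal{R}_2^*=\mathcal{R}^*$, i.e., $\mathcal{R}_2$ and $\mathcal{R}$ have the same Pareto boundary.
   Context: Preferential pliable index coding (PPICOD). A sender has $m\ge 1$ messages $X_{[1:m]}=(X_1,\dots,X_m)$, each taking values in a finite field $\mathbb{F}_q$ of size $q$, where $[a:b]=\{a,a+1,\dots,b\}$ and $X_S=(X_i:i\in S)$. There are $n\ge 1$ receivers; receiver $i\in[1:n]$ already knows $X_{H_i}$ for some $H_i\subsetneq[1:m]$. The problem is described by an $n\times m$ preference matrix $\boldsymbol{P}=[P_{i,j}]$ with entries in $\mathbb{R}\cup\{\infty\}$, where $P_{i,j}$ is the preference rank receiver $i$ gives to $X_j$ (lower is better); $P_{i,j}$ is finite if $j\in[1:m]\setminus H_i$ and $P_{i,j}=\infty$ if $j\in H_i$. A (linear) code of length $\ell$ consists of: an encoding function $\mathsf{E}:\mathbb{F}_q^m\to\mathbb{F}_q^\ell$ of the form $\mathsf{E}(X_{[1:m]})=\boldsymbol{A}\boldsymbol{X}$ with $\boldsymbol{A}\in\mathbb{F}_q^{\ell\times m}$ and $\boldsymbol{X}=[X_1\;\cdots\;X_m]^{\mathrm T}$; a decoding choice $D:[1:n]\to[1:m]$; and for each $i\in[1:n]$ a decoding function $\mathsf{G}_i:\mathbb{F}_q^\ell\times\mathbb{F}_q^{|H_i|}\to\mathbb{F}_q$; such that $D(i)\in[1:m]\setminus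 H_i$ and $\mathsf{G}_i(\mathsf{E}(X_{[1:m]}),X_{H_i})=X_{D(i)}$ for all $i\in[1:n]$ and all $X_{[1:m]}\in\mathbb{F}_q^m$. Only linear encoding functions are considered. The overall satisfaction metric of the code is $s=\sum_{i=1}^n P_{i,D(i)}$. A pair $(\ell,s)$ is achievable if there is a code with code length $\ell$ and overall satisfaction metric $s$. The feasible region $\mathcal{R}$ is the set of all achievable pairs $(\ell,s)$ over all linear codes. A point $(\ell_1,s_1)$ dominates $(\ell_2,s_2)$ if and only if $\ell_1\le\ell_2$ and $s_1\le s_2$ with at least one inequality strict. For a set $\mathcal{T}$ of achievable pairs, its Pareto boundary $\mathcal{T}^*$ is the set of all points of $\mathcal{T}$ not dominated by any point of $\mathcal{T}$. Method 2 (code centric). For each $m\times m$ matrix $\boldsymbol{A}$ over $\mathbb{F}_q$ in reduced row echelon form, and for each receiver $i\in[1:n]$: let $\boldsymbol{A}_{\setminus H_i}$ be the submatrix of $\boldsymbol{A}$ obtained by removing the columns indexed by $H_i$, and compute its reduced row echelon form. Each row of this reduced form containing exactly one non-zero element indicates a message decodable by receiver $i$, namely $X_j$ where $j$ is the index in $\boldsymbol{A}$ of the column containing that non-zero element. Let $p_i(\boldsymbol{A})$ be the smallest preference rank $P_{i,j}$ among the decodable messages of receiver $i$. If every receiver has at least one decodable message, record the pair $(\ell,s)$ where $\ell$ is the number of rows of $\boldsymbol{A}$ that are not all zero and $s=\sum_{i=1}^n p_i(\boldsymbol{A})$. The set $\mathcal{R}_2$ is the collection of all recorded pairs over all such $\boldsymbol{A}$.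 *)

theory Defs
  imports
    "HOL-Library.Extended_Real"
    "Jordan_Normal_Form.Gauss_Jordan_Elimination"
    "Jordan_Normal_Form.DL_Submatrix"
begin

(* Receivers are indexed by {..<n} and messages by {..<m}.  The alphabet is a type
   'a of sort {field, finite}; the library's notion row_echelon_form is the *reduced*
   row echelon form, and gauss_jordan_single computes it. *)

section \<open>Problems\<close>

definition ppicod :: "nat \<Rightarrow> nat \<Rightarrow> (nat \<Rightarrow> nat set) \<Rightarrow> ereal mat \<Rightarrow> bool" where
  "ppicod n m H P \<longleftrightarrow>
     1 \<le> n \<and> 1 \<le> m \<and> P \<in> carrier_mat n m \<and>
     (\<forall>i<n. H i \<subset> {..<m} \<and>
       (\<forall>j<m. if j \<in> H i then P $$ (i, j) = \<infinity> else \<bar>P $$ (i, j)\<bar> \<noteq> \<infinity>))"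

section \<open>Linear codes and the feasible region\<close>

(* The entries of X with index in the finite set S, in increasing order of the index:
   pick S k is the k-th smallest element of S. *)
definition subvector :: "'a vec \<Rightarrow> nat set \<Rightarrow> 'a vec" where
  "subvector X S = vec (card S) (\<lambda>k. X $ pick S k)"

definition linear_encoding :: "nat \<Rightarrow> nat \<Rightarrow> ('a::semiring_0 vec \<Rightarrow> 'a vec) \<Rightarrow> bool" where
  "linear_encoding l m E \<longleftrightarrow>
     (\<exists>A\<in>carrier_mat l m. \<forall>X\<in>carrier_vec m. E X = A *\<^sub>v X)"

definition linear_code ::
  "nat \<Rightarrow> nat \<Rightarrow> (nat \<Rightarrow> nat set) \<Rightarrow> nat \<Rightarrow> ('a::{field,finite} vec \<Rightarrow> 'a vec) \<Rightarrow>
   (nat \<Rightarrow> nat) \<Rightarrow> (nat \<Rightarrow> 'a vec \<Rightarrow> 'a vec \<Rightarrow> 'a) \<Rightarrow> bool" where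
  "linear_code n m H l E D G \<longleftrightarrow>
     linear_encoding l m E \<and>
     (\<forall>i<n. D i \<in> {..<m} - H i \<and>
       (\<forall>X\<in>carrier_vec m. G i (E X) (subvector X (H i)) = X $ D i))"

definition satisfaction :: "nat \<Rightarrow> ereal mat \<Rightarrow> (nat \<Rightarrow> nat) \<Rightarrow> ereal" where
  "satisfaction n P D = (\<Sum>i<n. P $$ (i, D i))"

definition feasible_region ::
  "'a::{field,finite} itself \<Rightarrow> nat \<Rightarrow> nat \<Rightarrow> (nat \<Rightarrow> nat set) \<Rightarrow> ereal mat \<Rightarrow> (nat \<times> ereal) set" where
  "feasible_region (_ :: 'a itself) n m H P =
     {(l, s). \<exists>(E :: 'a vec \<Rightarrow> 'a vec) D G. linear_code n m H l E D G \<and> s = satisfaction n P D}"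

section \<open>Pareto boundary\<close>

definition dominates :: "nat \<times> ereal \<Rightarrow> nat \<times> ereal \<Rightarrow> bool" where
  "dominates p q \<longleftrightarrow>
     fst p \<le> fst q \<and> snd p \<le> snd q \<and> (fst p < fst q \<or> snd p < snd q)"

definition pareto_boundary :: "(nat \<times> ereal) set \<Rightarrow> (nat \<times> ereal) set" where
  "pareto_boundary T = {t \<in> T. \<not> (\<exists>u\<in>T. dominates u t)}"

section \<open>The code-centric method\<close>

definition remove_cols :: "'a mat \<Rightarrow> nat set \<Rightarrow> 'a mat" where
  "remove_cols A S = submatrix A UNIV (- S)"

(* Column c of remove_cols A S is column pick (- S) c of A. *)
definition decodable_messages :: "'a::field mat \<Rightarrow> nat set \<Rightarrow> nat set" where
  "decodable_messages A S =
     (let B = gauss_jordan_single (remove_cols A S) in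
      {pick (- S) c | c. \<exists>r<dim_row B. {c'. c' < dim_col B \<and> B $$ (r, c') \<noteq> 0} = {c}})"

definition best_rank :: "(nat \<Rightarrow> nat set) \<Rightarrow> ereal mat \<Rightarrow> 'a::field mat \<Rightarrow> nat \<Rightarrow> ereal" where
  "best_rank H P A i = Min ((\<lambda>j. P $$ (i, j)) ` decodable_messages A (H i))"

definition num_nonzero_rows :: "'a::zero mat \<Rightarrow> nat" where
  "num_nonzero_rows A = card {r. r < dim_row A \<and> row A r \<noteq> 0\<^sub>v (dim_col A)}"

definition code_centric_pairs ::
  "'a::{field,finite} itself \<Rightarrow> nat \<Rightarrow> nat \<Rightarrow> (nat \<Rightarrow> nat set) \<Rightarrow> ereal mat \<Rightarrow> (nat \<times> ereal) set" where
  "code_centric_pairs (_ :: 'a itself) n m H P =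
     {(num_nonzero_rows A, \<Sum>i<n. best_rank H P A i) | A :: 'a mat.
        A \<in> carrier_mat m m \<and> row_echelon_form A \<and>
        (\<forall>i<n. decodable_messages A (H i) \<noteq> {})}"

end

theory Submission
  imports Defs
begin

text \<open>Message \<open>j\<close> is decodable from \<open>A X\<close> and side information \<open>X\<^sub>S\<close> iff every kernel vector of
  \<open>A\<close> vanishing on \<open>S\<close> vanishes at \<open>j\<close>. The same kernel condition characterises the unit rows
  inspected by Method 2, because a further nonzero entry in a pivot row belongs to a free column,
  whose kernel vector is nonzero at the pivot. Thus decodability depends on \<open>A\<close> only through its
  kernel, and an encoding matrix may be replaced by a square reduced row echelon form with no more
  nonzero rows. So \<open>\<R>\<^sub>2 \<subseteq> \<R>\<close> and every point of \<open>\<R>\<close> is weakly dominated by one of \<open>\<R>\<^sub>2\<close>.\<close>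

section \<open>Unit rows of a reduced row echelon form\<close>

text \<open>Equation \<open>r\<close> of the homogeneous system has a single term,
  \<open>A $$ (r, c) * v $ c = 0\<close>, whose coefficient is invertible.\<close>

lemma unit_row_imp_kernel_zero:
  fixes A :: "'a::field mat"
  assumes A: "A \<in> carrier_mat nr nc" and r: "r < nr"
    and unit: "{c'. c' < nc \<and> A $$ (r, c') \<noteq> 0} = {c}"
    and v: "v \<in> carrier_vec nc" and ker: "A *\<^sub>v v = 0\<^sub>v nr"
  shows "v $ c = 0"
proof -
  have c: "c < nc" "A $$ (r, c) \<noteq> 0"
    and zero: "\<And>j. j < nc \<Longrightarrow> j \<noteq> c \<Longrightarrow> A $$ (r, j) = 0" using unit by blast+
  have "0 = (A *\<^sub>v v) $ r" using ker r by simp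
  also have "\<dots> = (\<Sum>j = 0..<nc. A $$ (r, j) * v $ j)"
    using A r v by (auto simp: scalar_prod_def)
  also have "\<dots> = (\<Sum>j\<in>{c}. A $$ (r, j) * v $ j)"
    by (rule sum.mono_neutral_right) (use c zero in auto)
  finally show ?thesis using c by simp
qed

lemma rref_kernel_zero_imp_unit_row:
  fixes A :: "'a::field mat"
  assumes A: "A \<in> carrier_mat nr nc" and rref: "row_echelon_form A" and c: "c < nc"
    and ker: "\<And>v. v \<in> carrier_vec nc \<Longrightarrow> A *\<^sub>v v = 0\<^sub>v nr \<Longrightarrow> v $ c = 0"
  shows "\<exists>r<nr. {c'. c' < nc \<and> A $$ (r, c') \<noteq> 0} = {c}"
proof -
  have dim: "dim_row A = nr" "dim_col A = nc" using A by auto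
  obtain f where piv: "pivot_fun A f nc"
    using rref dim unfolding row_echelon_form_def by auto
  note pD = pivot_funD[OF dim(1) piv]
  \<comment> \<open>The value \<open>f i = nc\<close> encodes a zero row, which contributes no pivot
    column.\<close>
  have pivots: "snd ` set (pivot_positions A) = {f i | i. i < nr \<and> f i \<noteq> nc}"
    by (force simp: pivot_positions(1)[OF A piv])
  note free_vec = non_pivot_base[OF rref A]
  \<comment> \<open>If \<open>c\<close> were free, its base kernel vector would have entry 1 at
    \<open>c\<close>, against \<open>ker\<close>.\<close>
  have "c \<in> snd ` set (pivot_positions A)"
    using free_vec(1-3)[OF c] ker by fastforce
  then obtain r where r: "r < nr" "f r = c" unfolding pivots by auto
  have rc: "A $$ (r, c) = 1" using pD(4)[OF r(1)] r c by simp
  have "A $$ (r, c') = 0" if c': "c' < nc" "c' \<noteq> c" for c'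
  proof (cases "c' \<in> snd ` set (pivot_positions A)")
    case True
    then obtain i where "i < nr" "f i = c'" unfolding pivots by auto
    then show ?thesis using pD(5)[of i r] r c' by auto
  next
    case False
    \<comment> \<open>\<open>v\<close> is the kernel vector with 1 at the free column
      \<open>c'\<close> and 0 at all other free columns. Row \<open>r\<close> vanishes at every
      pivot column except \<open>c\<close>, so equation \<open>r\<close> leaves only
      \<open>v $ c + A $$ (r, c') = 0\<close>.\<close>
    define v where "v = non_pivot_base A (pivot_positions A) c'"
    note v = free_vec[OF c'(1) False, folded v_def]
    have zero: "A $$ (r, j) * v $ j = 0" if j: "j < nc" "j \<noteq> c" "j \<noteq> c'" for j
    proof (cases "j \<in> snd ` set (pivot_positions A)")
      case True
      then obtain i where "i < nr" "f i = j" unfolding pivots by auto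
      then show ?thesis using pD(5)[of i r] r j by auto
    next
      case False
      then show ?thesis using v(4)[of j] j by simp
    qed
    have "0 = (A *\<^sub>v v) $ r" using v r by simp
    also have "\<dots> = (\<Sum>j = 0..<nc. A $$ (r, j) * v $ j)"
      using A r v(1) by (auto simp: scalar_prod_def)
    also have "\<dots> = (\<Sum>j\<in>{c, c'}. A $$ (r, j) * v $ j)"
      by (rule sum.mono_neutral_right) (use c c' zero in auto)
    also have "\<dots> = v $ c + A $$ (r, c')" using c' rc v(2) by simp
    also have "v $ c = 0" using ker v(1,3) by blast
    finally show ?thesis by simp
  qed
  then have "{c'. c' < nc \<and> A $$ (r, c') \<noteq> 0} = {c}" using c rc by auto
  then show ?thesis using r by blast
qed

section \<open>Removing columns\<close>

text \<open>Later \<open>J\<close> is a complement \<open>- S\<close>, typically infinite with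
  \<open>card J = 0\<close>, so positions are bounded by the number of elements of \<open>J\<close>
  below \<open>n\<close> instead.\<close>

lemma pick_less_card:
  assumes "c < card {j. j < n \<and> j \<in> J}"
  shows "pick J c \<in> J" "card {a \<in> J. a < pick J c} = c"
proof -
  have *: "c < card J \<or> infinite J"
    using assms card_mono[of J "{j. j < n \<and> j \<in> J}"] by fastforce
  show "pick J c \<in> J" by (rule pick_in_set[OF *])
  show "card {a \<in> J. a < pick J c} = c" by (rule card_pick[OF *])
qed

lemma card_less_restrict:
  fixes j n :: nat
  assumes "j < n" "j \<in> J"
  shows "card {a \<in> J. a < j} < card {j. j < n \<and> j \<in> J}"
  by (rule psubset_card_mono) (use assms in auto)

lemma bij_betw_pick:
  "bij_betw (pick J) {0..<card {j. j < n \<and> j \<in> J}} {j. j < n \<and> j \<in> J}"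
proof (rule bij_betwI)
  show "pick J \<in> {0..<card {j. j < n \<and> j \<in> J}} \<rightarrow> {j. j < n \<and> j \<in> J}"
    using pick_less_card(1) pick_le by auto
  show "(\<lambda>j. card {a \<in> J. a < j}) \<in> {j. j < n \<and> j \<in> J} \<rightarrow> {0..<card {j. j < n \<and> j \<in> J}}"
    using card_less_restrict by auto
qed (auto simp: pick_less_card pick_card_in_set)

text \<open>The deleted columns only meet zero entries of \<open>Y\<close>. Hence the kernel of the
  submatrix corresponds to the kernel vectors of \<open>A\<close> that vanish outside
  \<open>J\<close>.\<close>

lemma submatrix_cols_mult_vec:
  fixes A :: "'a::semiring_0 mat"
  assumes A: "A \<in> carrier_mat nr nc" and Y: "Y \<in> carrier_vec nc"
    and zero: "\<And>j. j < nc \<Longrightarrow> j \<notin> J \<Longrightarrow> Y $ j = 0"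
  shows "submatrix A UNIV J *\<^sub>v vec (card {j. j < nc \<and> j \<in> J}) (\<lambda>c. Y $ pick J c) = A *\<^sub>v Y"
    (is "?B *\<^sub>v ?y = _")
proof (rule eq_vecI)
  let ?k = "card {j. j < nc \<and> j \<in> J}"
  have dim: "dim_row ?B = nr" "dim_col ?B = ?k" using A by (simp_all add: dim_submatrix)
  then show "dim_vec (?B *\<^sub>v ?y) = dim_vec (A *\<^sub>v Y)" using A by simp
  fix r assume "r < dim_vec (A *\<^sub>v Y)"
  then have r: "r < nr" using A by simp
  have "(?B *\<^sub>v ?y) $ r = (\<Sum>c = 0..<?k. ?B $$ (r, c) * Y $ pick J c)"
    using r dim by (auto simp: scalar_prod_def)
  also have "\<dots> = (\<Sum>c = 0..<?k. A $$ (r, pick J c) * Y $ pick J c)"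
    using A r by (intro sum.cong refl) (simp add: submatrix_index pick_UNIV)
  also have "\<dots> = (\<Sum>j | j < nc \<and> j \<in> J. A $$ (r, j) * Y $ j)"
    by (rule sum.reindex_bij_betw[OF bij_betw_pick])
  also have "\<dots> = (\<Sum>j = 0..<nc. A $$ (r, j) * Y $ j)"
    by (rule sum.mono_neutral_left) (auto simp: zero)
  also have "\<dots> = (A *\<^sub>v Y) $ r"
    using A Y r by (auto simp: scalar_prod_def)
  finally show "(?B *\<^sub>v ?y) $ r = (A *\<^sub>v Y) $ r" .
qed

section \<open>Decodability as a kernel condition\<close>

text \<open>By linearity, \<open>Y\<close> plays the role of the difference of two message vectors
  with the same codeword and the same side information on \<open>S\<close>.\<close>

definition kernel_determines :: "'a::semiring_0 mat \<Rightarrow> nat set \<Rightarrow> nat \<Rightarrow> bool" where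
  "kernel_determines A S j \<longleftrightarrow>
     (\<forall>Y\<in>carrier_vec (dim_col A).
        A *\<^sub>v Y = 0\<^sub>v (dim_row A) \<longrightarrow> (\<forall>k\<in>S. k < dim_col A \<longrightarrow> Y $ k = 0) \<longrightarrow> Y $ j = 0)"

lemma kernel_determines_cong:
  assumes "A \<in> carrier_mat k nc" "B \<in> carrier_mat l nc"
    and "\<And>Y. Y \<in> carrier_vec nc \<Longrightarrow> A *\<^sub>v Y = 0\<^sub>v k \<longleftrightarrow> B *\<^sub>v Y = 0\<^sub>v l"
  shows "kernel_determines A S j \<longleftrightarrow> kernel_determines B S j"
  using assms unfolding kernel_determines_def by auto

text \<open>Gauss-Jordan elimination keeps the kernel of the column-deleted matrix, and padding with
  zeros on \<open>S\<close> turns that kernel into the vectors tested by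
  \<open>kernel_determines\<close>.\<close>

lemma decodable_messages_iff:
  fixes A :: "'a::field mat"
  assumes A: "A \<in> carrier_mat nr nc"
  shows "j \<in> decodable_messages A S \<longleftrightarrow> j < nc \<and> j \<notin> S \<and> kernel_determines A S j"
proof -
  let ?J = "- S"
  let ?k = "card {j. j < nc \<and> j \<in> ?J}"
  define C where "C = remove_cols A S"
  define B where "B = gauss_jordan_single C"
  have C: "C \<in> carrier_mat nr ?k"
    using A by (auto simp: C_def remove_cols_def dim_submatrix)
  note gj = gauss_jordan_single[OF C B_def[symmetric]]
  have dimB: "dim_row B = nr" "dim_col B = ?k" using gj(2) by auto
  have dec: "j \<in> decodable_messages A S \<longleftrightarrow>
      (\<exists>c. j = pick ?J c \<and> (\<exists>r<nr. {c'. c' < ?k \<and> B $$ (r, c') \<noteq> 0} = {c}))"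
    unfolding decodable_messages_def Let_def C_def[symmetric] B_def[symmetric] dimB by auto
  show ?thesis
  proof
    assume "j \<in> decodable_messages A S"
    then obtain c r where j: "j = pick ?J c" and r: "r < nr"
      and unit: "{c'. c' < ?k \<and> B $$ (r, c') \<noteq> 0} = {c}" unfolding dec by blast
    have c: "c < ?k" using unit by blast
    have "kernel_determines A S j" unfolding kernel_determines_def
    proof (intro ballI impI)
      fix Y :: "'a vec"
      assume Y: "Y \<in> carrier_vec (dim_col A)" and ker: "A *\<^sub>v Y = 0\<^sub>v (dim_row A)"
        and zero: "\<forall>k\<in>S. k < dim_col A \<longrightarrow> Y $ k = 0"
      let ?y = "vec ?k (\<lambda>c. Y $ pick ?J c)"
      have "C *\<^sub>v ?y = A *\<^sub>v Y" unfolding C_def remove_cols_def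
        by (rule submatrix_cols_mult_vec[OF A]) (use A Y zero in auto)
      then have "B *\<^sub>v ?y = 0\<^sub>v nr" using gj(1)[of ?y] ker A by simp
      then have "?y $ c = 0"
        by (intro unit_row_imp_kernel_zero[OF gj(2) r unit]) auto
      then show "Y $ j = 0" using c j by simp
    qed
    then show "j < nc \<and> j \<notin> S \<and> kernel_determines A S j"
      using pick_less_card(1)[OF c] pick_le[OF c] j by auto
  next
    assume j: "j < nc \<and> j \<notin> S \<and> kernel_determines A S j"
    define c where "c = card {a \<in> ?J. a < j}"
    have c: "c < ?k" unfolding c_def by (rule card_less_restrict) (use j in auto)
    have pc: "pick ?J c = j" unfolding c_def by (rule pick_card_in_set) (use j in auto)
    have "\<exists>r<nr. {c'. c' < ?k \<and> B $$ (r, c') \<noteq> 0} = {c}"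
    proof (rule rref_kernel_zero_imp_unit_row[OF gj(2,3) c])
      fix y :: "'a vec" assume y: "y \<in> carrier_vec ?k" and ker: "B *\<^sub>v y = 0\<^sub>v nr"
      \<comment> \<open>Zero padding of \<open>y\<close>: the number of kept columns before
        \<open>i\<close> is the position of column \<open>i\<close> in the submatrix.\<close>
      define Y where "Y = vec nc (\<lambda>i. if i \<in> ?J then y $ card {a \<in> ?J. a < i} else 0)"
      have "vec ?k (\<lambda>c. Y $ pick ?J c) = y"
        using y pick_less_card[of _ nc ?J] pick_le[of _ nc ?J] by (intro eq_vecI) (auto simp: Y_def)
      then have "A *\<^sub>v Y = C *\<^sub>v y"
        using submatrix_cols_mult_vec[OF A, of Y ?J] unfolding C_def remove_cols_def
        by (simp add: Y_def)
      also have "\<dots> = 0\<^sub>v nr" using gj(1)[OF y] ker by simp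
      finally have "Y $ j = 0"
        using j A unfolding kernel_determines_def by (auto simp: Y_def)
      then show "y $ c = 0" using j by (simp add: Y_def c_def)
    qed
    then show "j \<in> decodable_messages A S" unfolding dec using pc by blast
  qed
qed

lemma subvector_eq_iff:
  assumes "finite S"
  shows "subvector X S = subvector Y S \<longleftrightarrow> (\<forall>k\<in>S. X $ k = Y $ k)"
proof
  assume eq: "subvector X S = subvector Y S"
  show "\<forall>k\<in>S. X $ k = Y $ k"
  proof
    fix k assume k: "k \<in> S"
    let ?c = "card {a \<in> S. a < k}"
    have "?c < card S" by (rule psubset_card_mono) (use assms k in auto)
    then have "X $ pick S ?c = Y $ pick S ?c"
      using arg_cong[OF eq, of "\<lambda>v. v $ ?c"] by (simp add: subvector_def)
    then show "X $ k = Y $ k" using pick_card_in_set[OF k] by simp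
  qed
next
  assume "\<forall>k\<in>S. X $ k = Y $ k"
  then show "subvector X S = subvector Y S"
    by (auto simp: subvector_def pick_in_set_le)
qed

lemma decoder_exists_iff:
  fixes A :: "'a::ring mat"
  assumes A: "A \<in> carrier_mat l m" and S: "S \<subseteq> {..<m}" and j: "j < m"
  shows "(\<exists>g. \<forall>X\<in>carrier_vec m. g (A *\<^sub>v X) (subvector X S) = X $ j) \<longleftrightarrow> kernel_determines A S j"
proof
  have fin: "finite S" using S finite_subset by blast
  assume "\<exists>g. \<forall>X\<in>carrier_vec m. g (A *\<^sub>v X) (subvector X S) = X $ j"
  then obtain g where g: "\<And>X. X \<in> carrier_vec m \<Longrightarrow> g (A *\<^sub>v X) (subvector X S) = X $ j" by blast
  show "kernel_determines A S j" unfolding kernel_determines_def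
  proof (intro ballI impI)
    fix Y :: "'a vec"
    assume Y: "Y \<in> carrier_vec (dim_col A)" and ker: "A *\<^sub>v Y = 0\<^sub>v (dim_row A)"
      and zero: "\<forall>k\<in>S. k < dim_col A \<longrightarrow> Y $ k = 0"
    \<comment> \<open>The decoder cannot distinguish \<open>Y\<close> from the zero message vector,
      so it must return the same symbol for both.\<close>
    have "subvector Y S = subvector (0\<^sub>v m) S"
      using zero S A by (auto simp: subvector_eq_iff[OF fin] subset_iff)
    moreover have "A *\<^sub>v Y = A *\<^sub>v 0\<^sub>v m" using ker A by auto
    ultimately have "Y $ j = 0\<^sub>v m $ j"
      using g[of Y] g[of "0\<^sub>v m"] Y A by simp
    then show "Y $ j = 0" using j by simp
  qed
next
  have fin: "finite S" using S finite_subset by blast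
  assume det: "kernel_determines A S j"
  have inj: "X $ j = Y $ j"
    if X: "X \<in> carrier_vec m" and Y: "Y \<in> carrier_vec m" and "A *\<^sub>v X = A *\<^sub>v Y"
      and sub: "subvector X S = subvector Y S" for X Y
  proof -
    have "A *\<^sub>v (X - Y) = 0\<^sub>v l"
      using that A by (simp add: mult_minus_distrib_mat_vec[OF A X Y])
    moreover have "\<forall>k\<in>S. (X - Y) $ k = 0"
      using sub S X Y by (auto simp: subvector_eq_iff[OF fin] subset_iff)
    ultimately have "(X - Y) $ j = 0"
      using det X Y A unfolding kernel_determines_def by auto
    then show ?thesis using j X Y by simp
  qed
  \<comment> \<open>The decoder returns entry \<open>j\<close> of some message vector consistent
    with what is received; \<open>inj\<close> makes the answer independent of the choice.\<close>
  define g where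
    "g e w = (SOME x. \<exists>X\<in>carrier_vec m. A *\<^sub>v X = e \<and> subvector X S = w \<and> x = X $ j)" for e w
  have "g (A *\<^sub>v X) (subvector X S) = X $ j" if X: "X \<in> carrier_vec m" for X
    unfolding g_def by (rule someI2[of _ "X $ j"]) (use X inj in blast)+
  then show "\<exists>g. \<forall>X\<in>carrier_vec m. g (A *\<^sub>v X) (subvector X S) = X $ j" by blast
qed

section \<open>Changing the number of rows\<close>

lemma mult_mat_vec_eq_0_iff:
  assumes "A \<in> carrier_mat nr nc"
  shows "A *\<^sub>v Y = 0\<^sub>v nr \<longleftrightarrow> (\<forall>i<nr. row A i \<bullet> Y = 0)"
  using assms by (auto simp: vec_eq_iff)

text \<open>Method 2 records only the nonzero rows as code length, so a code of that length needs an
  encoding matrix with exactly that many rows. Zero rows impose no equation.\<close>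

lemma drop_zero_rows:
  fixes A :: "'a::semiring_0 mat"
  assumes A: "A \<in> carrier_mat nr nc"
  obtains B where "B \<in> carrier_mat (num_nonzero_rows A) nc"
    and "\<And>Y. Y \<in> carrier_vec nc \<Longrightarrow>
      B *\<^sub>v Y = 0\<^sub>v (num_nonzero_rows A) \<longleftrightarrow> A *\<^sub>v Y = 0\<^sub>v nr"
proof -
  define I where "I = {r. r < nr \<and> row A r \<noteq> 0\<^sub>v nc}"
  define B where "B = mat_of_rows nc (map (row A) (sorted_list_of_set I))"
  have fin: "finite I" by (simp add: I_def)
  have k: "num_nonzero_rows A = card I"
    using A by (simp add: num_nonzero_rows_def I_def)
  have B: "B \<in> carrier_mat (card I) nc"
    by (auto simp: B_def)
  have "B *\<^sub>v Y = 0\<^sub>v (card I) \<longleftrightarrow> A *\<^sub>v Y = 0\<^sub>v nr" if Y: "Y \<in> carrier_vec nc" for Y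
  proof -
    have rowB: "row B i = row A (sorted_list_of_set I ! i)" if "i < card I" for i
      unfolding B_def using that A by (subst mat_of_rows_row) auto
    have "B *\<^sub>v Y = 0\<^sub>v (card I) \<longleftrightarrow> (\<forall>i<card I. row A (sorted_list_of_set I ! i) \<bullet> Y = 0)"
      using rowB by (simp add: mult_mat_vec_eq_0_iff[OF B])
    also have "\<dots> \<longleftrightarrow> (\<forall>r\<in>I. row A r \<bullet> Y = 0)"
      using fin by (metis in_set_conv_nth length_sorted_list_of_set set_sorted_list_of_set)
    also have "\<dots> \<longleftrightarrow> (\<forall>r<nr. row A r \<bullet> Y = 0)"
      using Y by (auto simp: I_def)
    also have "\<dots> \<longleftrightarrow> A *\<^sub>v Y = 0\<^sub>v nr"
      by (simp add: mult_mat_vec_eq_0_iff[OF A])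
    finally show ?thesis .
  qed
  then show thesis using that B k by metis
qed

text \<open>Row \<open>r\<close> of a reduced row echelon form has its pivot in a column \<open>\<ge> r\<close>, so all rows beyond
  the number of columns vanish and truncating to a square matrix keeps the kernel.\<close>

lemma square_rref_same_kernel:
  fixes A :: "'a::field mat"
  assumes A: "A \<in> carrier_mat l m"
  obtains B where "B \<in> carrier_mat m m" "row_echelon_form B" "num_nonzero_rows B \<le> l"
    and "\<And>Y. Y \<in> carrier_vec m \<Longrightarrow> B *\<^sub>v Y = 0\<^sub>v m \<longleftrightarrow> A *\<^sub>v Y = 0\<^sub>v l"
proof -
  define C where "C = gauss_jordan_single A"
  note gj = gauss_jordan_single[OF A C_def[symmetric]]
  have dim: "dim_row C = l" "dim_col C = m" using gj(2) by auto
  obtain f where piv: "pivot_fun C f m"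
    using gj(3) dim unfolding row_echelon_form_def by auto
  note pD = pivot_funD[OF dim(1) piv]
  \<comment> \<open>This truncates \<open>C\<close> if \<open>l > m\<close> and appends zero rows if
    \<open>l < m\<close>; an appended row gets the pivot value \<open>m\<close>, meaning no
    pivot.\<close>
  define B where "B = mat m m (\<lambda>(i, j). if i < l then C $$ (i, j) else 0)"
  have B: "B \<in> carrier_mat m m" by (simp add: B_def)
  have "pivot_fun B (\<lambda>i. if i < l then f i else m) m"
  proof (rule pivot_funI[where nr = m])
    fix i j assume "i < m" "j < (if i < l then f i else m)"
    then show "B $$ (i, j) = 0"
      using pD(1)[of i] pD(2)[of i j] by (cases "i < l") (auto simp: B_def)
  next
    fix i assume "i < m" "(if i < l then f i else m) < m"
    then show "B $$ (i, if i < l then f i else m) = 1"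
      using pD(4)[of i] by (cases "i < l") (auto simp: B_def)
  qed (use pD B in \<open>auto simp: B_def split: if_splits\<close>)
  then have rref: "row_echelon_form B" unfolding row_echelon_form_def using B by auto
  have "{r. r < dim_row B \<and> row B r \<noteq> 0\<^sub>v (dim_col B)} \<subseteq> {..<l}"
    by (auto simp: B_def vec_eq_iff split: if_splits)
  then have rows: "num_nonzero_rows B \<le> l"
    unfolding num_nonzero_rows_def by (metis card_lessThan card_mono finite_lessThan)
  have ker: "B *\<^sub>v Y = 0\<^sub>v m \<longleftrightarrow> A *\<^sub>v Y = 0\<^sub>v l" if Y: "Y \<in> carrier_vec m" for Y
  proof -
    have high: "row C i = 0\<^sub>v m" if "m \<le> i" "i < l" for i
    proof -
      \<comment> \<open>Pivots increase strictly until they reach \<open>m\<close>, so either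
        \<open>f i = m\<close> or \<open>f i \<ge> i \<ge> m\<close>; with
        \<open>f i \<le> m\<close> both cases agree.\<close>
      have "f i = m"
        using pivot_bound[OF dim(1) piv, of 0 i] pD(1)[of i] that by auto
      then show ?thesis using pivot_fun_zero_row_iff[OF piv gj(2)] that by simp
    qed
    have low: "row B i = (if i < l then row C i else 0\<^sub>v m)" if "i < m" for i
      using that dim by (auto simp: B_def vec_eq_iff)
    have "B *\<^sub>v Y = 0\<^sub>v m \<longleftrightarrow> (\<forall>i<m. row B i \<bullet> Y = 0)"
      by (rule mult_mat_vec_eq_0_iff[OF B])
    also have "\<dots> \<longleftrightarrow> (\<forall>i<l. row C i \<bullet> Y = 0)"
      using Y high low by (metis linorder_not_le scalar_prod_left_zero)
    also have "\<dots> \<longleftrightarrow> C *\<^sub>v Y = 0\<^sub>v l"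
      by (simp add: mult_mat_vec_eq_0_iff[OF gj(2)])
    finally show ?thesis using gj(1)[OF Y] by simp
  qed
  show thesis by (rule that[OF B rref rows ker])
qed

section \<open>Comparing the two regions\<close>

text \<open>A boundary point of \<open>T\<close> is weakly dominated from \<open>R\<close>, hence
  lies in \<open>R\<close>. Conversely, if a point of \<open>T\<close> dominates a point of
  \<open>R\<close>, then by transitivity so does some point of \<open>R\<close>.\<close>

lemma pareto_boundary_eqI:
  assumes "R \<subseteq> T"
    and "\<And>l s. (l, s) \<in> T \<Longrightarrow> \<exists>l' s'. (l', s') \<in> R \<and> l' \<le> l \<and> s' \<le> s"
  shows "pareto_boundary R = pareto_boundary T"
proof -
  have weak: "\<exists>u\<in>R. u = t \<or> dominates u t" if "t \<in> T" for t
    using assms(2)[of "fst t" "snd t"] that unfolding dominates_def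
    by (metis fst_conv order_le_imp_less_or_eq prod.collapse snd_conv)
  have trans: "dominates p r" if "dominates p q" "dominates q r" for p q r
    using that unfolding dominates_def by auto
  show ?thesis
    using assms(1) weak trans unfolding pareto_boundary_def by blast
qed

lemma code_centric_pairs_subset_feasible_region:
  assumes prob: "ppicod n m H P"
  shows "code_centric_pairs TYPE('a::{field,finite}) n m H P \<subseteq> feasible_region TYPE('a) n m H P"
proof
  fix p assume "p \<in> code_centric_pairs TYPE('a) n m H P"
  then obtain A :: "'a mat" where A: "A \<in> carrier_mat m m"
    and dec: "\<And>i. i < n \<Longrightarrow> decodable_messages A (H i) \<noteq> {}"
    and p: "p = (num_nonzero_rows A, \<Sum>i<n. best_rank H P A i)"
    unfolding code_centric_pairs_def by auto
  \<comment> \<open>The minimum over a finite nonempty set is attained, so each receiver can be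
    served a decodable message of best rank.\<close>
  have "\<exists>j. j \<in> decodable_messages A (H i) \<and> P $$ (i, j) = best_rank H P A i" if i: "i < n" for i
  proof -
    have "finite (decodable_messages A (H i))"
      by (rule finite_subset[of _ "{..<m}"]) (auto simp: decodable_messages_iff[OF A])
    then have "best_rank H P A i \<in> (\<lambda>j. P $$ (i, j)) ` decodable_messages A (H i)"
      unfolding best_rank_def by (intro Min_in) (use dec[OF i] in auto)
    then show ?thesis by auto
  qed
  then obtain D where D: "\<And>i. i < n \<Longrightarrow> D i \<in> decodable_messages A (H i)"
    and rank: "\<And>i. i < n \<Longrightarrow> P $$ (i, D i) = best_rank H P A i" by metis
  obtain B where B: "B \<in> carrier_mat (num_nonzero_rows A) m"
    and ker: "\<And>Y. Y \<in> carrier_vec m \<Longrightarrow>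
      B *\<^sub>v Y = 0\<^sub>v (num_nonzero_rows A) \<longleftrightarrow> A *\<^sub>v Y = 0\<^sub>v m"
    using drop_zero_rows[OF A] by blast
  have Di: "D i < m" "D i \<notin> H i" "kernel_determines B (H i) (D i)" if "i < n" for i
    using D[OF that] kernel_determines_cong[OF B A ker] by (auto simp: decodable_messages_iff[OF A])
  have "\<exists>g. \<forall>X\<in>carrier_vec m. g (B *\<^sub>v X) (subvector X (H i)) = X $ D i" if i: "i < n" for i
  proof -
    have "H i \<subseteq> {..<m}" using prob i unfolding ppicod_def by blast
    then show ?thesis using decoder_exists_iff[OF B] Di[OF i] by blast
  qed
  then obtain G where
    "\<And>i X. i < n \<Longrightarrow> X \<in> carrier_vec m \<Longrightarrow> G i (B *\<^sub>v X) (subvector X (H i)) = X $ D i"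
    by metis
  then have "linear_code n m H (num_nonzero_rows A) ((*\<^sub>v) B) D G"
    using B Di unfolding linear_code_def linear_encoding_def by auto
  moreover have "(\<Sum>i<n. best_rank H P A i) = satisfaction n P D"
    unfolding satisfaction_def using rank by simp
  ultimately show "p \<in> feasible_region TYPE('a) n m H P"
    unfolding feasible_region_def p by blast
qed

text \<open>Inclusion may fail here: a code may have redundant rows or a decoding choice that is not
  the best. Passing to the reduced form keeps every \<open>D i\<close> decodable, so minimising over
  the decodable messages can only lower the satisfaction sum.\<close>

lemma feasible_region_weakly_dominated:
  assumes prob: "ppicod n m H P"
    and "(l, s) \<in> feasible_region TYPE('a::{field,finite}) n m H P"
  shows "\<exists>l' s'. (l', s') \<in> code_centric_pairs TYPE('a) n m H P \<and> l' \<le> l \<and> s' \<le> s"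
proof -
  obtain E :: "'a vec \<Rightarrow> 'a vec" and D G where code: "linear_code n m H l E D G"
    and s: "s = satisfaction n P D"
    using assms(2) unfolding feasible_region_def by auto
  obtain A where A: "A \<in> carrier_mat l m" and E: "\<And>X. X \<in> carrier_vec m \<Longrightarrow> E X = A *\<^sub>v X"
    using code[unfolded linear_code_def, THEN conjunct1] unfolding linear_encoding_def by blast
  obtain B where B: "B \<in> carrier_mat m m" "row_echelon_form B" "num_nonzero_rows B \<le> l"
    and ker: "\<And>Y. Y \<in> carrier_vec m \<Longrightarrow> B *\<^sub>v Y = 0\<^sub>v m \<longleftrightarrow> A *\<^sub>v Y = 0\<^sub>v l"
    using square_rref_same_kernel[OF A] by blast
  have dec: "D i \<in> decodable_messages B (H i)" if i: "i < n" for i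
  proof -
    have Di: "D i < m" "D i \<notin> H i"
      and "\<forall>X\<in>carrier_vec m. G i (A *\<^sub>v X) (subvector X (H i)) = X $ D i"
      using code i E unfolding linear_code_def by auto
    moreover have "H i \<subseteq> {..<m}" using prob i unfolding ppicod_def by blast
    ultimately have "kernel_determines A (H i) (D i)"
      using decoder_exists_iff[OF A] by blast
    then show ?thesis
      using Di kernel_determines_cong[OF B(1) A ker] by (simp add: decodable_messages_iff[OF B(1)])
  qed
  have "best_rank H P B i \<le> P $$ (i, D i)" if i: "i < n" for i
  proof -
    have "finite (decodable_messages B (H i))"
      by (rule finite_subset[of _ "{..<m}"]) (auto simp: decodable_messages_iff[OF B(1)])
    then show ?thesis unfolding best_rank_def using dec[OF i] by (intro Min_le) auto
  qed
  then have "(\<Sum>i<n. best_rank H P B i) \<le> s"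
    unfolding s satisfaction_def by (intro sum_mono) auto
  moreover have "(num_nonzero_rows B, \<Sum>i<n. best_rank H P B i) \<in> code_centric_pairs TYPE('a) n m H P"
    using B dec unfolding code_centric_pairs_def by blast
  ultimately show ?thesis using B(3) by blast
qed

theorem proposition6:
  fixes n m :: nat
    and H :: "nat \<Rightarrow> nat set"
    and P :: "ereal mat"
  assumes "ppicod n m H P"
  shows "pareto_boundary (code_centric_pairs TYPE('a::{field,finite}) n m H P) =
         pareto_boundary (feasible_region TYPE('a) n m H P)"
proof (rule pareto_boundary_eqI)
  show "code_centric_pairs TYPE('a) n m H P \<subseteq> feasible_region TYPE('a) n m H P"
    by (rule code_centric_pairs_subset_feasible_region[OF assms])
next
  fix l s assume "(l, s) \<in> feasible_region TYPE('a) n m H P"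
  then show "\<exists>l' s'. (l', s') \<in> code_centric_pairs TYPE('a) n m H P \<and> l' \<le> l \<and> s' \<le> s"
    by (rule feasible_region_weakly_dominated[OF assms])
qed

end
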